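(* Let $G$ be a connected graph with $|V(G)|=m\geq 2$ and let $H$ be a non-rigid graph. Then $fix_f(G\odot H)=m\, fix_f(H)$.
   Context: All graphs are finite, simple and undirected. A graph is rigid if its automorphism group is trivial, and non-rigid otherwise. The corona product $G\odot H$ is the graph obtained from one copy of $G$ and $|V(G)|$ disjoint copies of $H$, one copy $H_u$ for each vertex $u\in V(G)$, by joining each vertex of $H_u$ by an edge to $u$. Let $\Gamma=\Gamma(G)$ be the automorphism group of a graph $G$. For $u\in V(G)$, $O(u)$ is the $\Gamma$-orbit of $u$; for $x\in V(G)$, $\Gamma_x$ is the stabilizer of $x$ and $O_x(u)=\{\pi(u):\pi\in\Gamma_x\}$. Let $V_a(G)=\{(u,v): u\neq v,\ O(u)=O(v)\}$. For vertices $u,v$ let $F(u,v)=\{x\in V(G):O_x(u)\neq O_x(v)\}$. A function $g:V(G)\to[0,1]$ is a fixing function of $G$ if $\sum_{x\in F(u,v)}g(x)\ge 1$ for every $(u,v)\in V_a(G)$. Put $|g|=\sum_{x\in V(G)}g(x)$. The fractional fixing number $fix_f(G)$ is the minimum of $|g|$ over all fixing functions $g$ of $G$. *)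

theory Defs
  imports "HOL-Analysis.Analysis" "HOL-Combinatorics.Permutations" "Graph_Theory.Graph_Theory"
begin

text \<open>
  A finite simple undirected graph is a \<^typ>\<open>'a pair_pre_digraph\<close> satisfying \<^const>\<open>pair_graph\<close>:
  finitely many vertices, and a symmetric irreflexive relation \<^const>\<open>parcs\<close> containing both
  orientations of every edge.
\<close>

text \<open>
  Automorphisms are functions on the whole type. Those outside the vertex set are the identity
  (this is part of \<^const>\<open>permutes\<close>), so distinct elements of \<open>Aut G\<close> are
  distinct automorphisms.
\<close>

definition Aut :: "'a pair_pre_digraph \<Rightarrow> ('a \<Rightarrow> 'a) set" where
  "Aut G = {\<pi>. \<pi> permutes pverts G \<and>
     (\<forall>u\<in>pverts G. \<forall>v\<in>pverts G. (\<pi> u, \<pi> v) \<in> parcs G \<longleftrightarrow> (u, v) \<in> parcs G)}"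

definition rigid :: "'a pair_pre_digraph \<Rightarrow> bool" where
  "rigid G \<longleftrightarrow> Aut G = {id}"

definition orbit_of :: "'a pair_pre_digraph \<Rightarrow> 'a \<Rightarrow> 'a set" where
  "orbit_of G u = {\<pi> u |\<pi>. \<pi> \<in> Aut G}"

definition vertex_stabilizer :: "'a pair_pre_digraph \<Rightarrow> 'a \<Rightarrow> ('a \<Rightarrow> 'a) set" where
  "vertex_stabilizer G x = {\<pi> \<in> Aut G. \<pi> x = x}"

definition stabilizer_orbit :: "'a pair_pre_digraph \<Rightarrow> 'a \<Rightarrow> 'a \<Rightarrow> 'a set" where
  "stabilizer_orbit G x u = {\<pi> u |\<pi>. \<pi> \<in> vertex_stabilizer G x}"

definition V_a :: "'a pair_pre_digraph \<Rightarrow> ('a \<times> 'a) set" where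
  "V_a G = {(u, v). u \<in> pverts G \<and> v \<in> pverts G \<and> u \<noteq> v \<and> orbit_of G u = orbit_of G v}"

definition fixing_set :: "'a pair_pre_digraph \<Rightarrow> 'a \<Rightarrow> 'a \<Rightarrow> 'a set" where
  "fixing_set G u v = {x \<in> pverts G. stabilizer_orbit G x u \<noteq> stabilizer_orbit G x v}"

text \<open>The values of \<open>g\<close> outside the vertex set are irrelevant.\<close>

definition fixing_function :: "'a pair_pre_digraph \<Rightarrow> ('a \<Rightarrow> real) \<Rightarrow> bool" where
  "fixing_function G g \<longleftrightarrow>
     (\<forall>x\<in>pverts G. g x \<in> {0..1}) \<and> (\<forall>(u, v)\<in>V_a G. (\<Sum>x\<in>fixing_set G u v. g x) \<ge> 1)"

definition weight :: "'a pair_pre_digraph \<Rightarrow> ('a \<Rightarrow> real) \<Rightarrow> real" where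
  "weight G g = (\<Sum>x\<in>pverts G. g x)"

text \<open>
  For finite vertex sets this minimum exists: see \<open>fix_f_attained\<close> and \<open>fix_f_le\<close> below.
\<close>

definition fix_f :: "'a pair_pre_digraph \<Rightarrow> real" where
  "fix_f G = (LEAST r. \<exists>g. fixing_function G g \<and> weight G g = r)"

text \<open>
  In the corona product, \<open>Inl u\<close> is the vertex \<open>u\<close> of \<open>G\<close> and
  \<open>Inr (u, h)\<close> is the vertex \<open>h\<close> of the copy of \<open>H\<close> attached to \<open>u\<close>.
\<close>

definition corona :: "'a pair_pre_digraph \<Rightarrow> 'b pair_pre_digraph \<Rightarrow> ('a + 'a \<times> 'b) pair_pre_digraph"
    (infixl "\<odot>" 70) where
  "G \<odot> H = \<lparr> pverts = Inl ` pverts G \<union> Inr ` (pverts G \<times> pverts H),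
     parcs = {(Inl u, Inl v) |u v. (u, v) \<in> parcs G}
       \<union> {(Inr (u, h), Inr (u, k)) |u h k. u \<in> pverts G \<and> (h, k) \<in> parcs H}
       \<union> {(Inl u, Inr (u, h)) |u h. u \<in> pverts G \<and> h \<in> pverts H}
       \<union> {(Inr (u, h), Inl u) |u h. u \<in> pverts G \<and> h \<in> pverts H} \<rparr>"

lemma pair_graph_corona:
  assumes "pair_graph G" "pair_graph H"
  shows "pair_graph (G \<odot> H)"
proof -
  interpret G: pair_graph G by fact
  interpret H: pair_graph H by fact
  have symG: "(u, v) \<in> parcs G \<Longrightarrow> (v, u) \<in> parcs G" for u v
    using G.pair_sym_arcs by (auto simp: symmetric_def sym_def)
  have symH: "(u, v) \<in> parcs H \<Longrightarrow> (v, u) \<in> parcs H" for u v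
    using H.pair_sym_arcs by (auto simp: symmetric_def sym_def)
  have fin: "finite (pverts (G \<odot> H))"
    by (simp add: corona_def G.pair_finite_verts H.pair_finite_verts)
  have sub: "parcs (G \<odot> H) \<subseteq> pverts (G \<odot> H) \<times> pverts (G \<odot> H)"
    by (auto simp: corona_def dest: G.wellformed' H.wellformed')
  show ?thesis
  proof
    show "finite (pverts (G \<odot> H))" by (fact fin)
    show "finite (parcs (G \<odot> H))"
      using sub fin by (meson finite_SigmaI finite_subset)
    show "symmetric (with_proj (G \<odot> H))"
      by (auto simp: symmetric_def sym_def corona_def intro: symG symH)
    show "fst e \<noteq> snd e" if "e \<in> parcs (G \<odot> H)" for e
      using that by (auto simp: corona_def dest: G.pair_no_loops H.pair_no_loops)
  qed (use sub in auto)
qed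

lemma fixing_function_const_1:
  assumes "finite (pverts G)"
  shows "fixing_function G (\<lambda>_. 1)"
proof -
  have "card (fixing_set G u v) \<ge> 1" if "(u, v) \<in> V_a G" for u v
  proof -
    have id: "id \<in> Aut G"
      by (auto simp: Aut_def permutes_id)
    have "v \<in> stabilizer_orbit G u v"
      unfolding stabilizer_orbit_def vertex_stabilizer_def using id by (intro CollectI exI[of _ id]) simp
    moreover have "stabilizer_orbit G u u \<subseteq> {u}"
      by (auto simp: stabilizer_orbit_def vertex_stabilizer_def)
    ultimately have "u \<in> fixing_set G u v"
      using that by (auto simp: fixing_set_def V_a_def)
    moreover have "finite (fixing_set G u v)"
      using assms by (simp add: fixing_set_def)
    ultimately show ?thesis
      by (metis One_nat_def Suc_leI card_gt_0_iff empty_iff)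
  qed
  then show ?thesis
    by (force simp: fixing_function_def)
qed

lemma minimum_weight_exists:
  assumes fin: "finite (pverts G)"
  shows "\<exists>g. fixing_function G g \<and> (\<forall>h. fixing_function G h \<longrightarrow> weight G g \<le> weight G h)"
proof -
  define B where "B = (\<Pi>\<^sub>E x\<in>UNIV. if x \<in> pverts G then {0..1::real} else {0})"
  define C where "C = (\<Inter>(u, v)\<in>V_a G. {g::'a \<Rightarrow> real. (\<Sum>x\<in>fixing_set G u v. g x) \<ge> 1})"
  have "compactin (product_topology (\<lambda>_. euclidean) UNIV) B"
    unfolding B_def by (subst compactin_PiE) auto
  then have "compact B"
    by (simp add: euclidean_product_topology)
  moreover have "closed C"
    unfolding C_def by (intro closed_INT ballI) (auto intro!: closed_Collect_le continuous_intros)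
  ultimately have comp: "compact (B \<inter> C)"
    by (simp add: compact_Int_closed)
  have BC: "fixing_function G g" if "g \<in> B \<inter> C" for g
    using that by (fastforce simp: B_def C_def fixing_function_def PiE_iff split: if_splits)
  define cut where "cut g = (\<lambda>x. if x \<in> pverts G then g x else 0)" for g :: "'a \<Rightarrow> real"
  have sums: "(\<Sum>x\<in>A. cut g x) = (\<Sum>x\<in>A. g x)" if "A \<subseteq> pverts G" for A g
    using that by (auto simp: cut_def intro!: sum.cong)
  have cut: "cut g \<in> B \<inter> C" if "fixing_function G g" for g
  proof -
    have "fixing_set G u v \<subseteq> pverts G" for u v
      by (auto simp: fixing_set_def)
    then show ?thesis
      using that by (auto simp: B_def C_def fixing_function_def sums) (auto simp: cut_def)
  qed
  have "B \<inter> C \<noteq> {}"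
    using cut[OF fixing_function_const_1[OF fin]] by blast
  moreover have "continuous_on (B \<inter> C) (weight G)"
    unfolding weight_def
    by (intro continuous_on_sum continuous_on_subset[OF continuous_on_product_coordinates]) auto
  ultimately obtain g where g: "g \<in> B \<inter> C" "\<And>h. h \<in> B \<inter> C \<Longrightarrow> weight G g \<le> weight G h"
    using continuous_attains_inf[OF comp] by blast
  have "weight G g \<le> weight G h" if "fixing_function G h" for h
    using g(2)[OF cut[OF that]] sums[of "pverts G" h] by (simp add: weight_def)
  with BC g(1) show ?thesis by blast
qed

lemma fix_f_attained:
  assumes "finite (pverts G)"
  shows "\<exists>g. fixing_function G g \<and> weight G g = fix_f G"
proof -
  obtain g where g: "fixing_function G g" "\<And>h. fixing_function G h \<Longrightarrow> weight G g \<le> weight G h"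
    using minimum_weight_exists[OF assms] by blast
  have "fix_f G = weight G g"
    unfolding fix_f_def by (rule Least_equality) (use g in auto)
  with g show ?thesis by auto
qed

lemma fix_f_le:
  assumes "finite (pverts G)" "fixing_function G h"
  shows "fix_f G \<le> weight G h"
proof -
  obtain g where g: "fixing_function G g" "\<And>h. fixing_function G h \<Longrightarrow> weight G g \<le> weight G h"
    using minimum_weight_exists[OF assms(1)] by blast
  have "fix_f G = weight G g"
    unfolding fix_f_def by (rule Least_equality) (use g in auto)
  with g assms show ?thesis by auto
qed

end

theory Submission
  imports Defs
begin

text \<open>
  In the corona every vertex \<open>Inl u\<close> of the base graph has more neighbours than any vertex of a
  copy of \<open>H\<close>: it sees all of its own copy and, as \<open>G\<close> is connected with at least two vertices, some
  vertex of \<open>G\<close>, whereas a vertex of a copy sees at most its root and the other vertices of its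
  copy. So automorphisms of the corona preserve the base, hence permute the copies
  (\<open>Aut_corona_Inl_iff\<close>, \<open>Aut_corona_root\<close>). An automorphism fixing a root restricts to an automorphism
  of \<open>H\<close> on its copy, and conversely any automorphism of \<open>H\<close> can act on one copy alone
  (\<open>restrict_to_copy_Aut\<close>, \<open>act_on_copy_Aut\<close>).

  Two kinds of pairs then have to be told apart. For two vertices of the same copy only vertices of
  that copy help, and they help exactly as in \<open>H\<close> (\<open>fixing_set_same_copy\<close>); so a fixing function of
  the corona restricts to a fixing function of \<open>H\<close> on each of the \<open>m\<close> copies, which
  gives \<open>\<ge>\<close>. For two vertices with different roots, every vertex of the copy at the first root
  helps (\<open>copy_subset_fixing_set\<close>). Hence an optimal fixing function of \<open>H\<close>, repeated on every
  copy and extended by zero to the base, is a fixing function: its weight on one copy is at least 1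
  because \<open>H\<close> is not rigid. This gives \<open>\<le>\<close>.
\<close>

section \<open>Orbits and fixing sets in terms of single automorphisms\<close>

lemma Aut_id: "id \<in> Aut G"
  by (simp add: Aut_def permutes_id)

lemma Aut_permutes: "\<pi> \<in> Aut G \<Longrightarrow> \<pi> permutes pverts G"
  by (simp add: Aut_def)

lemma Aut_arc_iff:
  "\<pi> \<in> Aut G \<Longrightarrow> u \<in> pverts G \<Longrightarrow> v \<in> pverts G \<Longrightarrow> (\<pi> u, \<pi> v) \<in> parcs G \<longleftrightarrow> (u, v) \<in> parcs G"
  by (simp add: Aut_def)

lemma Aut_comp:
  assumes \<pi>: "\<pi> \<in> Aut G" and \<rho>: "\<rho> \<in> Aut G"
  shows "\<rho> \<circ> \<pi> \<in> Aut G"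
proof -
  have "((\<rho> \<circ> \<pi>) u, (\<rho> \<circ> \<pi>) v) \<in> parcs G \<longleftrightarrow> (u, v) \<in> parcs G"
    if "u \<in> pverts G" "v \<in> pverts G" for u v
    using that by (simp add: Aut_arc_iff[OF \<pi>] Aut_arc_iff[OF \<rho>] permutes_in_image[OF Aut_permutes[OF \<pi>]])
  with permutes_compose[OF Aut_permutes[OF \<pi>] Aut_permutes[OF \<rho>]] show ?thesis
    unfolding Aut_def by blast
qed

lemma Aut_inv:
  assumes \<pi>: "\<pi> \<in> Aut G"
  shows "inv \<pi> \<in> Aut G"
proof -
  note perm = Aut_permutes[OF \<pi>]
  have "(inv \<pi> u, inv \<pi> v) \<in> parcs G \<longleftrightarrow> (u, v) \<in> parcs G"
    if "u \<in> pverts G" "v \<in> pverts G" for u v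
    using that Aut_arc_iff[OF \<pi>, of "inv \<pi> u" "inv \<pi> v"]
    by (simp add: permutes_inverses[OF perm] permutes_in_image[OF permutes_inv[OF perm]])
  with permutes_inv[OF perm] show ?thesis
    unfolding Aut_def by blast
qed

text \<open>
  Orbits of a permutation group are equal or disjoint, so comparing two orbits amounts to asking for
  one group element. Applied to \<open>Aut G\<close> and to its vertex stabilizers, this turns \<open>V_a\<close> and
  the fixing sets into statements about the existence of a single automorphism.
\<close>

lemma permutation_group_orbit_eq_iff:
  assumes "id \<in> A"
    and "\<And>\<pi> \<rho>. \<pi> \<in> A \<Longrightarrow> \<rho> \<in> A \<Longrightarrow> \<rho> \<circ> \<pi> \<in> A"
    and "\<And>\<pi>. \<pi> \<in> A \<Longrightarrow> inv \<pi> \<in> A"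
    and "\<And>\<pi>. \<pi> \<in> A \<Longrightarrow> bij \<pi>"
  shows "{\<pi> u |\<pi>. \<pi> \<in> A} = {\<pi> v |\<pi>. \<pi> \<in> A} \<longleftrightarrow> (\<exists>\<pi>\<in>A. \<pi> u = v)"
proof
  assume eq: "{\<pi> u |\<pi>. \<pi> \<in> A} = {\<pi> v |\<pi>. \<pi> \<in> A}"
  have "v \<in> {\<pi> u |\<pi>. \<pi> \<in> A}"
    unfolding eq using assms(1) by (intro CollectI exI[of _ id]) simp
  then show "\<exists>\<pi>\<in>A. \<pi> u = v"
    by (simp add: Bex_def eq_commute conj_commute)
next
  assume "\<exists>\<pi>\<in>A. \<pi> u = v"
  then obtain \<pi> where \<pi>: "\<pi> \<in> A" "v = \<pi> u" by blast
  have "\<exists>\<sigma>. \<rho> u = \<sigma> v \<and> \<sigma> \<in> A" if "\<rho> \<in> A" for \<rho>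
    using \<pi> assms that
    by (intro exI[of _ "\<rho> \<circ> inv \<pi>"]) (simp add: bij_is_inj)
  moreover have "\<exists>\<sigma>. \<rho> v = \<sigma> u \<and> \<sigma> \<in> A" if "\<rho> \<in> A" for \<rho>
    using \<pi> assms(2) that by (intro exI[of _ "\<rho> \<circ> \<pi>"]) simp
  ultimately show "{\<pi> u |\<pi>. \<pi> \<in> A} = {\<pi> v |\<pi>. \<pi> \<in> A}" by auto
qed

lemma V_a_iff:
  "(u, v) \<in> V_a G \<longleftrightarrow> u \<in> pverts G \<and> v \<in> pverts G \<and> u \<noteq> v \<and> (\<exists>\<pi>\<in>Aut G. \<pi> u = v)"
proof -
  have "orbit_of G u = orbit_of G v \<longleftrightarrow> (\<exists>\<pi>\<in>Aut G. \<pi> u = v)"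
    unfolding orbit_of_def
    by (rule permutation_group_orbit_eq_iff)
       (auto intro: Aut_id Aut_comp Aut_inv permutes_bij[OF Aut_permutes])
  then show ?thesis by (auto simp: V_a_def)
qed

lemma fixing_set_iff:
  "x \<in> fixing_set G u v \<longleftrightarrow> x \<in> pverts G \<and> \<not> (\<exists>\<pi>\<in>Aut G. \<pi> x = x \<and> \<pi> u = v)"
proof -
  have "stabilizer_orbit G x u = stabilizer_orbit G x v \<longleftrightarrow> (\<exists>\<pi>\<in>vertex_stabilizer G x. \<pi> u = v)"
    unfolding stabilizer_orbit_def
  proof (rule permutation_group_orbit_eq_iff)
    show "inv \<pi> \<in> vertex_stabilizer G x" if "\<pi> \<in> vertex_stabilizer G x" for \<pi>
      using that Aut_inv[of \<pi> G] permutes_inverses(2)[OF Aut_permutes, of \<pi> G x]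
      by (auto simp: vertex_stabilizer_def)
  qed (auto simp: vertex_stabilizer_def intro: Aut_id Aut_comp permutes_bij[OF Aut_permutes])
  then show ?thesis by (auto simp: fixing_set_def vertex_stabilizer_def)
qed

lemma fixing_set_subset: "fixing_set G u v \<subseteq> pverts G"
  by (auto simp: fixing_set_def)

lemma not_rigid_obtains_V_a:
  assumes "\<not> rigid G"
  obtains u v where "(u, v) \<in> V_a G"
proof -
  obtain \<pi> where \<pi>: "\<pi> \<in> Aut G" "\<pi> \<noteq> id"
    using assms Aut_id by (auto simp: rigid_def)
  then obtain u where u: "\<pi> u \<noteq> u" by (auto simp: fun_eq_iff)
  have "u \<in> pverts G"
    using u Aut_permutes[OF \<pi>(1)] by (auto dest: permutes_not_in)
  moreover have "\<pi> u \<in> pverts G"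
    using calculation Aut_permutes[OF \<pi>(1)] by (simp add: permutes_in_image)
  ultimately have "(u, \<pi> u) \<in> V_a G"
    using u \<pi>(1) by (auto simp: V_a_iff)
  then show ?thesis by (rule that)
qed

lemma fixing_function_weight_ge_1:
  assumes "finite (pverts G)" "\<not> rigid G" "fixing_function G g"
  shows "weight G g \<ge> 1"
proof -
  obtain u v where uv: "(u, v) \<in> V_a G"
    using assms(2) by (rule not_rigid_obtains_V_a)
  have "1 \<le> (\<Sum>x\<in>fixing_set G u v. g x)"
    using assms(3) uv by (auto simp: fixing_function_def)
  also have "\<dots> \<le> (\<Sum>x\<in>pverts G. g x)"
    using assms by (intro sum_mono2) (auto simp: fixing_set_subset fixing_function_def)
  finally show ?thesis by (simp add: weight_def)
qed

lemma Aut_card_neighbours: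
  assumes "\<pi> \<in> Aut G" "p \<in> pverts G"
  shows "card {q \<in> pverts G. (\<pi> p, q) \<in> parcs G} = card {q \<in> pverts G. (p, q) \<in> parcs G}"
proof -
  have "bij_betw \<pi> {q \<in> pverts G. (p, q) \<in> parcs G} {q \<in> pverts G. (\<pi> p, q) \<in> parcs G}"
  proof (rule bij_betw_subset[OF permutes_imp_bij[OF Aut_permutes[OF assms(1)]]])
    show "\<pi> ` {q \<in> pverts G. (p, q) \<in> parcs G} = {q \<in> pverts G. (\<pi> p, q) \<in> parcs G}"
      using assms permutes_image[OF Aut_permutes[OF assms(1)]]
      by (force simp: Aut_arc_iff)
  qed auto
  then show ?thesis by (simp add: bij_betw_same_card)
qed

section \<open>Automorphisms of the corona\<close>

lemma corona_verts [simp]: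
  "Inl u \<in> pverts (G \<odot> H) \<longleftrightarrow> u \<in> pverts G"
  "Inr (u, h) \<in> pverts (G \<odot> H) \<longleftrightarrow> u \<in> pverts G \<and> h \<in> pverts H"
  by (auto simp: corona_def)

lemma corona_arcs [simp]:
  "(Inl u, Inl v) \<in> parcs (G \<odot> H) \<longleftrightarrow> (u, v) \<in> parcs G"
  "(Inl u, Inr (v, h)) \<in> parcs (G \<odot> H) \<longleftrightarrow> u = v \<and> u \<in> pverts G \<and> h \<in> pverts H"
  "(Inr (v, h), Inl u) \<in> parcs (G \<odot> H) \<longleftrightarrow> u = v \<and> u \<in> pverts G \<and> h \<in> pverts H"
  "(Inr (u, h), Inr (v, k)) \<in> parcs (G \<odot> H) \<longleftrightarrow> u = v \<and> u \<in> pverts G \<and> (h, k) \<in> parcs H"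
  by (auto simp: corona_def)

fun root :: "'a + 'a \<times> 'b \<Rightarrow> 'a" where
  "root (Inl u) = u"
| "root (Inr (u, h)) = u"

fun act_on_copy :: "'a \<Rightarrow> ('b \<Rightarrow> 'b) \<Rightarrow> 'a + 'a \<times> 'b \<Rightarrow> 'a + 'a \<times> 'b" where
  "act_on_copy u \<tau> (Inl v) = Inl v"
| "act_on_copy u \<tau> (Inr (v, h)) = Inr (v, if v = u then \<tau> h else h)"

lemma act_on_copy_Aut:
  assumes "\<tau> \<in> Aut H" "u \<in> pverts G"
  shows "act_on_copy u \<tau> \<in> Aut (G \<odot> H)"
proof -
  note perm = Aut_permutes[OF assms(1)]
  have inverse: "act_on_copy u \<rho> (act_on_copy u \<sigma> p) = p"
    if "\<And>h. \<rho> (\<sigma> h) = h" for \<rho> \<sigma> and p :: "'b + 'b \<times> 'a"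
    using that by (cases "(u, \<sigma>, p)" rule: act_on_copy.cases) auto
  have "bij (act_on_copy u \<tau>)"
    by (rule bij_betw_byWitness[where f' = "act_on_copy u (inv \<tau>)"])
       (auto simp: inverse permutes_inverses[OF perm])
  moreover have "act_on_copy u \<tau> p = p" if "p \<notin> pverts (G \<odot> H)" for p
    using that assms(2) permutes_not_in[OF perm]
    by (cases "(u, \<tau>, p)" rule: act_on_copy.cases) auto
  ultimately have "act_on_copy u \<tau> permutes pverts (G \<odot> H)"
    by (simp add: bij_iff permutes_def)
  moreover have "(act_on_copy u \<tau> p, act_on_copy u \<tau> q) \<in> parcs (G \<odot> H) \<longleftrightarrow> (p, q) \<in> parcs (G \<odot> H)"
    if "p \<in> pverts (G \<odot> H)" "q \<in> pverts (G \<odot> H)" for p q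
    using that assms(1) perm
    by (cases "(u, \<tau>, p)" rule: act_on_copy.cases; cases "(u, \<tau>, q)" rule: act_on_copy.cases)
       (auto simp: Aut_arc_iff permutes_in_image)
  ultimately show ?thesis by (simp add: Aut_def)
qed

locale corona_without_isolated_base =
  fixes G :: "'a pair_pre_digraph" and H :: "'b pair_pre_digraph"
  assumes graph_G: "pair_graph G" and graph_H: "pair_graph H"
    and neighbour: "u \<in> pverts G \<Longrightarrow> \<exists>v\<in>pverts G. (u, v) \<in> parcs G"
begin

lemma finite_G: "finite (pverts G)" and finite_H: "finite (pverts H)"
  using graph_G graph_H
  by (simp_all add: pair_graph_def pair_digraph_def pair_fin_digraph_def pair_fin_digraph_axioms_def)

lemma finite_corona: "finite (pverts (G \<odot> H))"
  by (simp add: corona_def finite_G finite_H)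

lemma card_neighbours_Inl:
  assumes "u \<in> pverts G"
  shows "card {q \<in> pverts (G \<odot> H). (Inl u, q) \<in> parcs (G \<odot> H)} > card (pverts H)"
proof -
  obtain v where v: "v \<in> pverts G" "(u, v) \<in> parcs G"
    using neighbour[OF assms] by blast
  have "card (insert (Inl v) ((\<lambda>h. Inr (u, h)) ` pverts H) :: ('a + 'a \<times> 'b) set) = Suc (card (pverts H))"
    using finite_H by (subst card_insert_disjoint) (auto simp: card_image inj_on_def)
  moreover have "card (insert (Inl v) ((\<lambda>h. Inr (u, h)) ` pverts H))
      \<le> card {q \<in> pverts (G \<odot> H). (Inl u, q) \<in> parcs (G \<odot> H)}"
    using v assms finite_corona by (intro card_mono) auto
  ultimately show ?thesis by simp
qed

lemma card_neighbours_Inr: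
  assumes "h \<in> pverts H"
  shows "card {q \<in> pverts (G \<odot> H). (Inr (u, h), q) \<in> parcs (G \<odot> H)} \<le> card (pverts H)"
proof -
  interpret H: pair_graph H by (fact graph_H)
  have "{q \<in> pverts (G \<odot> H). (Inr (u, h), q) \<in> parcs (G \<odot> H)}
      \<subseteq> insert (Inl u) ((\<lambda>k. Inr (u, k)) ` (pverts H - {h}))" (is "?N \<subseteq> ?M")
  proof
    fix q assume q: "q \<in> ?N"
    show "q \<in> ?M"
    proof (cases q rule: root.cases)
      case (1 v)
      with q show ?thesis by simp
    next
      case (2 v k)
      with q have "v = u" "(h, k) \<in> parcs H" "k \<in> pverts H" by simp_all
      then show ?thesis
        using 2 H.pair_no_loops[of "(h, k)"] by simp
    qed
  qed
  then have "card ?N \<le> card ?M"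
    using finite_H by (intro card_mono) auto
  also have "\<dots> \<le> Suc (card (pverts H - {h}))"
    using finite_H by (subst card_insert_disjoint) (auto simp: card_image inj_on_def)
  also have "\<dots> = card (pverts H)"
    using finite_H assms by (rule card_Suc_Diff1)
  finally show ?thesis .
qed

lemma Aut_corona_Inl_iff:
  assumes "\<pi> \<in> Aut (G \<odot> H)" "p \<in> pverts (G \<odot> H)"
  shows "isl (\<pi> p) \<longleftrightarrow> isl p"
proof -
  have degree: "isl q \<longleftrightarrow> card {r \<in> pverts (G \<odot> H). (q, r) \<in> parcs (G \<odot> H)} > card (pverts H)"
    if "q \<in> pverts (G \<odot> H)" for q
    using that card_neighbours_Inl card_neighbours_Inr by (cases q rule: root.cases) (auto simp: not_less)
  moreover have "\<pi> p \<in> pverts (G \<odot> H)"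
    using assms by (simp add: permutes_in_image Aut_permutes)
  ultimately show ?thesis
    using assms by (simp add: Aut_card_neighbours)
qed

lemma Aut_corona_Inl:
  assumes "\<pi> \<in> Aut (G \<odot> H)" "u \<in> pverts G"
  obtains v where "v \<in> pverts G" "\<pi> (Inl u) = Inl v"
proof -
  have "\<pi> (Inl u) \<in> pverts (G \<odot> H)"
    using assms by (simp add: permutes_in_image Aut_permutes)
  moreover have "isl (\<pi> (Inl u))"
    using assms by (simp add: Aut_corona_Inl_iff)
  then obtain v where "\<pi> (Inl u) = Inl v"
    by (auto simp: isl_def)
  ultimately show ?thesis
    using that by simp
qed

lemma Aut_corona_Inr:
  assumes \<pi>: "\<pi> \<in> Aut (G \<odot> H)" and u: "u \<in> pverts G" and h: "h \<in> pverts H"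
  obtains k where "k \<in> pverts H" "\<pi> (Inr (u, h)) = Inr (root (\<pi> (Inl u)), k)"
proof -
  obtain v where "\<pi> (Inl u) = Inl v"
    using \<pi> u by (rule Aut_corona_Inl)
  moreover have "\<pi> (Inr (u, h)) \<in> pverts (G \<odot> H)" "\<not> isl (\<pi> (Inr (u, h)))"
    using assms Aut_corona_Inl_iff[of \<pi> "Inr (u, h)"] by (simp_all add: permutes_in_image Aut_permutes)
  then obtain w k where "\<pi> (Inr (u, h)) = Inr (w, k)" "k \<in> pverts H"
    by (cases "\<pi> (Inr (u, h))" rule: root.cases) auto
  moreover have "(\<pi> (Inl u), \<pi> (Inr (u, h))) \<in> parcs (G \<odot> H)"
    using assms by (simp add: Aut_arc_iff)
  ultimately show ?thesis
    using that by simp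
qed

text \<open>
  A vertex of a copy is adjacent to its root and to no other base vertex, so where its image lies is
  decided by the image of the root.
\<close>

lemma Aut_corona_root:
  assumes "\<pi> \<in> Aut (G \<odot> H)" "p \<in> pverts (G \<odot> H)"
  shows "root (\<pi> p) = root (\<pi> (Inl (root p)))"
proof (cases p rule: root.cases)
  case (2 u h)
  then have "u \<in> pverts G" "h \<in> pverts H"
    using assms(2) by simp_all
  with assms(1) obtain k where "\<pi> (Inr (u, h)) = Inr (root (\<pi> (Inl u)), k)"
    by (rule Aut_corona_Inr)
  then show ?thesis
    by (simp add: 2)
qed simp

lemma Aut_corona_Inl_fixed:
  assumes "\<pi> \<in> Aut (G \<odot> H)" "p \<in> pverts (G \<odot> H)" "root (\<pi> p) = root p"
  shows "\<pi> (Inl (root p)) = Inl (root p)"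
proof -
  have "root p \<in> pverts G"
    using assms(2) by (cases p rule: root.cases) auto
  with assms(1) obtain v where "\<pi> (Inl (root p)) = Inl v"
    by (rule Aut_corona_Inl)
  with Aut_corona_root[OF assms(1,2)] assms(3) show ?thesis by simp
qed

text \<open>
  Outside \<open>pverts H\<close> the restriction is the identity, as an element of \<open>Aut H\<close> has to be.
\<close>

definition restrict_to_copy :: "'a \<Rightarrow> ('a + 'a \<times> 'b \<Rightarrow> 'a + 'a \<times> 'b) \<Rightarrow> 'b \<Rightarrow> 'b" where
  "restrict_to_copy u \<pi> h = (if h \<in> pverts H then snd (projr (\<pi> (Inr (u, h)))) else h)"

lemma restrict_to_copy:
  assumes "\<pi> \<in> Aut (G \<odot> H)" "u \<in> pverts G" "\<pi> (Inl u) = Inl u" "h \<in> pverts H"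
  shows "\<pi> (Inr (u, h)) = Inr (u, restrict_to_copy u \<pi> h)" "restrict_to_copy u \<pi> h \<in> pverts H"
proof -
  obtain k where "k \<in> pverts H" "\<pi> (Inr (u, h)) = Inr (root (\<pi> (Inl u)), k)"
    using assms(1,2,4) by (rule Aut_corona_Inr)
  then show "\<pi> (Inr (u, h)) = Inr (u, restrict_to_copy u \<pi> h)" "restrict_to_copy u \<pi> h \<in> pverts H"
    using assms(3,4) by (simp_all add: restrict_to_copy_def)
qed

lemma restrict_to_copy_Aut:
  assumes \<pi>: "\<pi> \<in> Aut (G \<odot> H)" and u: "u \<in> pverts G" and fixed: "\<pi> (Inl u) = Inl u"
  shows "restrict_to_copy u \<pi> \<in> Aut H"
proof -
  note eq = restrict_to_copy[OF assms]
  have "inj_on (restrict_to_copy u \<pi>) (pverts H)"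
  proof (rule inj_onI)
    fix h k assume hk: "h \<in> pverts H" "k \<in> pverts H" "restrict_to_copy u \<pi> h = restrict_to_copy u \<pi> k"
    then have "\<pi> (Inr (u, h)) = \<pi> (Inr (u, k))"
      by (simp add: eq)
    then show "h = k"
      using permutes_inj[OF Aut_permutes[OF \<pi>]] by (auto dest: injD)
  qed
  moreover have "restrict_to_copy u \<pi> ` pverts H = pverts H"
    using finite_H _ calculation by (rule endo_inj_surj) (use eq(2) in auto)
  ultimately have "restrict_to_copy u \<pi> permutes pverts H"
    by (intro bij_imp_permutes) (simp_all add: bij_betw_def restrict_to_copy_def)
  moreover have "(restrict_to_copy u \<pi> h, restrict_to_copy u \<pi> k) \<in> parcs H \<longleftrightarrow> (h, k) \<in> parcs H"
    if "h \<in> pverts H" "k \<in> pverts H" for h k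
    using Aut_arc_iff[OF \<pi>, of "Inr (u, h)" "Inr (u, k)"] that u by (simp add: eq)
  ultimately show ?thesis by (simp add: Aut_def)
qed

section \<open>Fixing sets of the corona\<close>

lemma V_a_same_copy:
  assumes u: "u \<in> pverts G"
  shows "(Inr (u, h), Inr (u, k)) \<in> V_a (G \<odot> H) \<longleftrightarrow> (h, k) \<in> V_a H"
proof
  assume "(Inr (u, h), Inr (u, k)) \<in> V_a (G \<odot> H)"
  then obtain \<pi> where \<pi>: "\<pi> \<in> Aut (G \<odot> H)" "\<pi> (Inr (u, h)) = Inr (u, k)"
    and hk: "h \<in> pverts H" "k \<in> pverts H" "h \<noteq> k"
    by (auto simp: V_a_iff)
  have fixed: "\<pi> (Inl u) = Inl u"
    using Aut_corona_Inl_fixed[of \<pi> "Inr (u, h)"] \<pi> u hk by simp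
  have "restrict_to_copy u \<pi> h = k"
    using restrict_to_copy(1)[OF \<pi>(1) u fixed hk(1)] \<pi>(2) by simp
  then show "(h, k) \<in> V_a H"
    using hk restrict_to_copy_Aut[OF \<pi>(1) u fixed] by (auto simp: V_a_iff)
next
  assume "(h, k) \<in> V_a H"
  then obtain \<tau> where "\<tau> \<in> Aut H" "\<tau> h = k" "h \<in> pverts H" "k \<in> pverts H" "h \<noteq> k"
    by (auto simp: V_a_iff)
  then show "(Inr (u, h), Inr (u, k)) \<in> V_a (G \<odot> H)"
    using u by (auto simp: V_a_iff intro!: bexI[OF _ act_on_copy_Aut[of \<tau>]])
qed

text \<open>
  No vertex outside the copy separates the two, because an automorphism of \<open>H\<close> carrying \<open>h\<close> to \<open>k\<close>
  may act on this copy alone. A vertex of the copy fixes the root, so that only the automorphisms of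
  \<open>H\<close> fixing that vertex remain.
\<close>

lemma fixing_set_same_copy:
  assumes u: "u \<in> pverts G" and "(h, k) \<in> V_a H"
  shows "fixing_set (G \<odot> H) (Inr (u, h)) (Inr (u, k)) = (\<lambda>l. Inr (u, l)) ` fixing_set H h k"
proof (rule set_eqI)
  fix x
  obtain \<tau> where \<tau>: "\<tau> \<in> Aut H" "\<tau> h = k" and h: "h \<in> pverts H"
    using assms(2) by (auto simp: V_a_iff)
  show "x \<in> fixing_set (G \<odot> H) (Inr (u, h)) (Inr (u, k)) \<longleftrightarrow> x \<in> (\<lambda>l. Inr (u, l)) ` fixing_set H h k"
  proof (cases "\<exists>l\<in>pverts H. x = Inr (u, l)")
    case True
    then obtain l where l: "l \<in> pverts H" "x = Inr (u, l)" by blast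
    have "(\<exists>\<pi>\<in>Aut (G \<odot> H). \<pi> (Inr (u, l)) = Inr (u, l) \<and> \<pi> (Inr (u, h)) = Inr (u, k))
        \<longleftrightarrow> (\<exists>\<sigma>\<in>Aut H. \<sigma> l = l \<and> \<sigma> h = k)" (is "?L \<longleftrightarrow> ?R")
    proof
      assume ?L
      then obtain \<pi> where \<pi>: "\<pi> \<in> Aut (G \<odot> H)" "\<pi> (Inr (u, l)) = Inr (u, l)" "\<pi> (Inr (u, h)) = Inr (u, k)"
        by blast
      have fixed: "\<pi> (Inl u) = Inl u"
        using Aut_corona_Inl_fixed[of \<pi> "Inr (u, h)"] \<pi> u h by simp
      show ?R
        using restrict_to_copy(1)[OF \<pi>(1) u fixed] \<pi>(2,3) l(1) h
        by (intro bexI[OF _ restrict_to_copy_Aut[OF \<pi>(1) u fixed]]) simp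
    next
      assume ?R
      then obtain \<sigma> where "\<sigma> \<in> Aut H" "\<sigma> l = l" "\<sigma> h = k" by blast
      then show ?L
        by (intro bexI[OF _ act_on_copy_Aut[OF _ u, of \<sigma>]]) simp_all
    qed
    with l u show ?thesis by (auto simp: fixing_set_iff)
  next
    case False
    then have "act_on_copy u \<tau> x = x" if "x \<in> pverts (G \<odot> H)"
      using that by (cases "(u, \<tau>, x)" rule: act_on_copy.cases) auto
    then have "x \<notin> fixing_set (G \<odot> H) (Inr (u, h)) (Inr (u, k))"
      using \<tau>(2) bexI[OF _ act_on_copy_Aut[OF \<tau>(1) u]] by (simp add: fixing_set_iff)
    then show ?thesis
      using False fixing_set_subset[of H h k] by auto
  qed
qed

text \<open>
  Fixing a vertex of the copy at \<open>root p\<close> fixes \<open>root p\<close> itself, so \<open>p\<close> cannot leave its root.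
\<close>

lemma copy_subset_fixing_set:
  assumes p: "p \<in> pverts (G \<odot> H)" and "root p \<noteq> root q"
  shows "(\<lambda>l. Inr (root p, l)) ` pverts H \<subseteq> fixing_set (G \<odot> H) p q"
proof -
  have u: "root p \<in> pverts G"
    using p by (cases p rule: root.cases) auto
  have "\<pi> p \<noteq> q"
    if "l \<in> pverts H" and \<pi>: "\<pi> \<in> Aut (G \<odot> H)" "\<pi> (Inr (root p, l)) = Inr (root p, l)" for l \<pi>
  proof -
    have "\<pi> (Inl (root p)) = Inl (root p)"
      using Aut_corona_Inl_fixed[of \<pi> "Inr (root p, l)"] that u by simp
    then have "root (\<pi> p) = root p"
      using Aut_corona_root[OF \<pi>(1) p] by simp
    with assms(2) show ?thesis by auto
  qed
  with u show ?thesis by (auto simp: fixing_set_iff)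
qed

text \<open>
  A vertex of \<open>G\<close> and a vertex of its own copy have the same root but lie in different orbits, so
  the following cases are all.
\<close>

lemma V_a_corona_cases:
  assumes "(p, q) \<in> V_a (G \<odot> H)"
  obtains (different_root) "root p \<noteq> root q"
  | (same_copy) u h k where "u \<in> pverts G" "(h, k) \<in> V_a H" "p = Inr (u, h)" "q = Inr (u, k)"
proof (cases "root p = root q")
  case True
  have "p \<noteq> q" "isl p \<longleftrightarrow> isl q"
    using assms Aut_corona_Inl_iff by (auto simp: V_a_iff)
  with True obtain u h k where pq: "p = Inr (u, h)" "q = Inr (u, k)"
    by (cases p rule: root.cases; cases q rule: root.cases) auto
  moreover have "u \<in> pverts G"
    using assms pq by (auto simp: V_a_iff)
  ultimately show ?thesis
    using assms by (intro same_copy) (auto simp: V_a_same_copy)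
qed (rule different_root)

section \<open>Fixing functions of the corona\<close>

lemma weight_corona:
  "weight (G \<odot> H) g = (\<Sum>u\<in>pverts G. g (Inl u)) + (\<Sum>u\<in>pverts G. weight H (\<lambda>h. g (Inr (u, h))))"
proof -
  have "weight (G \<odot> H) g = (\<Sum>p\<in>Inl ` pverts G. g p) + (\<Sum>p\<in>Inr ` (pverts G \<times> pverts H). g p)"
    unfolding weight_def corona_def using finite_G finite_H
    by (simp, subst sum.union_disjoint) auto
  also have "\<dots> = (\<Sum>u\<in>pverts G. g (Inl u)) + (\<Sum>p\<in>pverts G \<times> pverts H. g (Inr p))"
    by (simp add: sum.reindex)
  finally show ?thesis
    by (simp add: weight_def sum.cartesian_product case_prod_unfold)
qed

lemma fixing_function_restrict_to_copy:
  assumes g: "fixing_function (G \<odot> H) g" and u: "u \<in> pverts G"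
  shows "fixing_function H (\<lambda>h. g (Inr (u, h)))"
proof -
  have "(\<Sum>l\<in>fixing_set H h k. g (Inr (u, l))) \<ge> 1" if "(h, k) \<in> V_a H" for h k
  proof -
    have "1 \<le> (\<Sum>x\<in>fixing_set (G \<odot> H) (Inr (u, h)) (Inr (u, k)). g x)"
      using g that u V_a_same_copy[OF u, of h k] by (auto simp: fixing_function_def)
    then show ?thesis
      by (simp add: fixing_set_same_copy[OF u that] sum.reindex inj_on_def)
  qed
  with g u show ?thesis by (auto simp: fixing_function_def)
qed

text \<open>
  Non-rigidity is needed for vertices with different roots: a rigid \<open>H\<close> has the zero function as a
  fixing function, and repeating it would separate no two copies.
\<close>

lemma fixing_function_repeat_on_copies:
  assumes f: "fixing_function H f" and "\<not> rigid H"
  shows "fixing_function (G \<odot> H) (case_sum (\<lambda>_. 0) (\<lambda>(u, h). f h))" (is "fixing_function _ ?g")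
proof -
  have range: "?g x \<in> {0..1}" if "x \<in> pverts (G \<odot> H)" for x
    using that f by (cases x rule: root.cases) (auto simp: fixing_function_def)
  have "(\<Sum>x\<in>fixing_set (G \<odot> H) p q. ?g x) \<ge> 1" if pq: "(p, q) \<in> V_a (G \<odot> H)" for p q
    using pq
  proof (cases rule: V_a_corona_cases)
    case different_root
    have p: "p \<in> pverts (G \<odot> H)"
      using pq by (simp add: V_a_iff)
    have "1 \<le> (\<Sum>h\<in>pverts H. f h)"
      using fixing_function_weight_ge_1[OF finite_H assms(2) f] by (simp add: weight_def)
    also have "\<dots> = (\<Sum>x\<in>(\<lambda>l. Inr (root p, l)) ` pverts H. ?g x)"
      by (simp add: sum.reindex inj_on_def)
    also have "\<dots> \<le> (\<Sum>x\<in>fixing_set (G \<odot> H) p q. ?g x)"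
    proof (rule sum_mono2)
      show "finite (fixing_set (G \<odot> H) p q)"
        using fixing_set_subset finite_corona by (rule finite_subset)
      show "?g x \<ge> 0" if "x \<in> fixing_set (G \<odot> H) p q - (\<lambda>l. Inr (root p, l)) ` pverts H" for x
        using range[of x] that by (simp add: fixing_set_iff)
    qed (rule copy_subset_fixing_set[OF p different_root])
    finally show ?thesis .
  next
    case (same_copy u h k)
    then show ?thesis
      using f by (auto simp: fixing_set_same_copy sum.reindex inj_on_def fixing_function_def)
  qed
  with range show ?thesis by (auto simp: fixing_function_def)
qed

lemma fix_f_corona:
  assumes "\<not> rigid H"
  shows "fix_f (G \<odot> H) = real (card (pverts G)) * fix_f H"
proof (rule antisym)
  obtain f where f: "fixing_function H f" "weight H f = fix_f H"
    using fix_f_attained[OF finite_H] by blast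
  have "fix_f (G \<odot> H) \<le> weight (G \<odot> H) (case_sum (\<lambda>_. 0) (\<lambda>(u, h). f h))"
    using finite_corona fixing_function_repeat_on_copies[OF f(1) assms] by (rule fix_f_le)
  then show "fix_f (G \<odot> H) \<le> real (card (pverts G)) * fix_f H"
    by (simp add: weight_corona f(2))
next
  obtain g where g: "fixing_function (G \<odot> H) g" "weight (G \<odot> H) g = fix_f (G \<odot> H)"
    using fix_f_attained[OF finite_corona] by blast
  have "real (card (pverts G)) * fix_f H \<le> (\<Sum>u\<in>pverts G. weight H (\<lambda>h. g (Inr (u, h))))"
    using fix_f_le[OF finite_H fixing_function_restrict_to_copy[OF g(1)]]
    by (simp add: sum_bounded_below)
  also have "\<dots> \<le> weight (G \<odot> H) g"
    using g(1) by (auto simp: weight_corona fixing_function_def intro!: sum_nonneg)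
  finally show "real (card (pverts G)) * fix_f H \<le> fix_f (G \<odot> H)"
    by (simp add: g(2))
qed

end

section \<open>Connected base graphs\<close>

lemma connected_no_isolated:
  assumes "pair_graph G" "Digraph_Component.connected (with_proj G)" "card (pverts G) \<ge> 2"
    and u: "u \<in> pverts G"
  shows "\<exists>v\<in>pverts G. (u, v) \<in> parcs G"
proof -
  interpret G: pair_graph G by fact
  obtain w where w: "w \<in> pverts G" "w \<noteq> u"
    using assms(3) by (metis card_2_iff' card_le_Suc0_iff_eq G.pair_finite_verts not_less_eq_eq numeral_2_eq_2 u)
  have "u \<rightarrow>\<^sup>*\<^bsub>with_proj (mk_symmetric (with_proj G))\<^esub> w"
    using assms(2) u w(1) by (simp add: Digraph_Component.connected_def strongly_connected_def)
  then have "u \<rightarrow>\<^sup>*\<^bsub>with_proj G\<^esub> w"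
    by (simp add: G.reachable_mk_symmetric_eq[OF G.pair_sym_arcs])
  then show ?thesis
    using w(2) by (cases rule: G.converse_reachable_cases) (auto dest: G.wellformed'(2))
qed

theorem theorem5p2:
  fixes G :: "'a pair_pre_digraph" and H :: "'b pair_pre_digraph" and m :: nat
  assumes "pair_graph G" and "Digraph_Component.connected (with_proj G)"
    and "card (pverts G) = m" and "m \<ge> 2"
    and "pair_graph H" and "\<not> rigid H"
  shows "fix_f (G \<odot> H) = real m * fix_f H"
proof -
  interpret corona_without_isolated_base G H
    using assms(1,5) connected_no_isolated[OF assms(1,2)] assms(3,4)
    by (intro corona_without_isolated_base.intro) auto
  show ?thesis
    using fix_f_corona[OF assms(6)] assms(3) by simp
qed

end
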